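(* Let $\kappa$, $\theta$ and $\lambda$ be infinite cardinals with $\operatorname{cf}(\lambda)=\theta$, let $D$ be a $(\kappa,\theta)$-weakly normal ultrafilter on $\kappa$, and assume that $\lambda$ is $\kappa$-strong. Then there is a sequence of cardinals $\bar\lambda=\langle\lambda_i : i<\kappa\rangle$ such that $\lambda=\lim_D(\bar\lambda)$ and $\left|\prod_{i<\kappa}\lambda_i/D\right|=\lambda$.
   Context: A cardinal $\lambda$ is $\kappa$-strong if $|\alpha|^{\kappa}<\lambda$ for every ordinal $\alpha<\lambda$. Regressive functions: for $g:\kappa\to\theta$, a function $f:\kappa\to\theta$ is $(\kappa,g)$-regressive if $f(i)<g(i)$ for every $i<\kappa$ with $g(i)>0$. Weak normality: let $D$ be an ultrafilter on $\kappa$ and $g:\kappa\to\theta$. $D$ is $(\kappa,g)$-weakly normal if (i) for every $\epsilon<\theta$, $\{i<\kappa: g(i)\ge\epsilon\}\in D$; and (ii) for every $(\kappa,g)$-regressive $f:\kappa\to\theta$ there is $j_f<\theta$ such that $\{i<\kappa: f(i)<j_f\}\in D$. $D$ is $(\kappa,\theta)$-weakly normal if it is $(\kappa,g)$-weakly normal for some $g:\kappa\to\theta$. Limit along $D$: for a sequence $\bar\lambda=\langle\lambda_i:i<\kappa\rangle$ of cardinals, $\lim_D(\bar\lambda)$ is the unique cardinal $\mu$ such that $\{i<\kappa:\beta<\lambda_i\le\mu\}\in D$ for every $\beta<\mu$. $\prod_{i<\kappa}\lambda_i/D$ is the ultraproduct of the sets $\lambda_i$ modulo $D$. *)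

theory Defs
  imports Complex_Main "HOL-Library.FuncSet"
begin

unbundle cardinal_syntax

text \<open>
  Ordinals and cardinals are well-orders as in \<^theory>\<open>HOL.BNF_Cardinal_Order_Relation\<close>.
  The elements of the ordinal \<open>r\<close> are the elements of \<^term>\<open>Field r\<close>; an element \<open>a\<close> stands for the
  ordinal below \<open>r\<close> whose set of predecessors is \<^term>\<open>underS r a\<close> and whose order is
  \<^term>\<open>Restr r (underS r a)\<close>. Thus \<open>x < y\<close> in \<open>r\<close> is \<^term>\<open>x \<in> underS r y\<close>, and \<open>x \<le> y\<close> is
  \<^term>\<open>(x, y) \<in> r\<close>.
\<close>

definition has_cofinality :: "'l rel \<Rightarrow> 't rel \<Rightarrow> bool" where
  "has_cofinality l t \<longleftrightarrow>
     (\<exists>A \<subseteq> Field l. cofinal A l \<and> |A| =o t) \<and>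
     (\<forall>A \<subseteq> Field l. cofinal A l \<longrightarrow> t \<le>o |A| )"

definition strong_over :: "'k rel \<Rightarrow> 'l rel \<Rightarrow> bool" where
  "strong_over k l \<longleftrightarrow> (\<forall>a \<in> Field l. |underS l a| ^c k <o l)"

text \<open>
  A set \<open>X \<subseteq> A\<close> belongs to the ultrafilter iff \<open>eventually (\<lambda>i. i \<in> X) D\<close>; being below
  \<^term>\<open>principal A\<close> makes \<open>D\<close> a filter on \<open>A\<close> rather than on the whole type.
\<close>

definition ultrafilter_on :: "'a set \<Rightarrow> 'a filter \<Rightarrow> bool" where
  "ultrafilter_on A D \<longleftrightarrow> D \<le> principal A \<and> D \<noteq> bot \<and>
     (\<forall>P. eventually P D \<or> eventually (\<lambda>x. \<not> P x) D)"

definition regressive :: "'k rel \<Rightarrow> 't rel \<Rightarrow> ('k \<Rightarrow> 't) \<Rightarrow> ('k \<Rightarrow> 't) \<Rightarrow> bool" where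
  "regressive k t g f \<longleftrightarrow> f \<in> Field k \<rightarrow> Field t \<and>
     (\<forall>i \<in> Field k. underS t (g i) \<noteq> {} \<longrightarrow> f i \<in> underS t (g i))"

definition weakly_normal_wrt :: "'k rel \<Rightarrow> 't rel \<Rightarrow> ('k \<Rightarrow> 't) \<Rightarrow> 'k filter \<Rightarrow> bool" where
  "weakly_normal_wrt k t g D \<longleftrightarrow> g \<in> Field k \<rightarrow> Field t \<and>
     (\<forall>e \<in> Field t. \<forall>\<^sub>F i in D. (e, g i) \<in> t) \<and>
     (\<forall>f. regressive k t g f \<longrightarrow> (\<exists>j \<in> Field t. \<forall>\<^sub>F i in D. f i \<in> underS t j))"

definition weakly_normal :: "'k rel \<Rightarrow> 't rel \<Rightarrow> 'k filter \<Rightarrow> bool" where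
  "weakly_normal k t D \<longleftrightarrow> (\<exists>g. weakly_normal_wrt k t g D)"

definition is_lim_along :: "'k filter \<Rightarrow> ('k \<Rightarrow> 'l rel) \<Rightarrow> 'm rel \<Rightarrow> bool" where
  "is_lim_along D L m \<longleftrightarrow> Card_order m \<and>
     (\<forall>b \<in> Field m. \<forall>\<^sub>F i in D. Restr m (underS m b) <o L i \<and> L i \<le>o m)"

text \<open>
  The limit is unique up to \<open>=o\<close>, leaving aside the cardinal 0, for which the defining condition
  is vacuous.
\<close>

lemma is_lim_along_not_less:
  assumes D: "D \<noteq> bot" and m: "is_lim_along D L m" "Field m \<noteq> {}"
    and m': "is_lim_along D L m'"
  shows "\<not> m <o m'"
proof
  assume less: "m <o m'"
  have W: "Well_order m" "Well_order m'"
    using m(1) m' by (auto simp: is_lim_along_def card_order_on_well_order_on)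
  obtain b where b: "b \<in> Field m'" "m =o Restr m' (underS m' b)"
    using less ordLess_iff_ordIso_Restr[OF W(2,1)] by blast
  obtain b0 where b0: "b0 \<in> Field m"
    using m(2) by blast
  have "\<forall>\<^sub>F i in D. Restr m' (underS m' b) <o L i"
    using m' b(1) unfolding is_lim_along_def by (auto elim: eventually_mono)
  moreover have "\<forall>\<^sub>F i in D. L i \<le>o m"
    using m(1) b0 unfolding is_lim_along_def by (auto elim: eventually_mono)
  ultimately have "\<forall>\<^sub>F i in D. False"
  proof eventually_elim
    case (elim i)
    have "m <o L i" using b(2) elim(1) by (rule ordIso_ordLess_trans)
    then show False using elim(2) not_ordLess_ordLeq by blast
  qed
  then show False using D by (simp add: trivial_limit_def)
qed

lemma is_lim_along_unique:
  assumes "D \<noteq> bot" "is_lim_along D L m" "Field m \<noteq> {}" "is_lim_along D L m'" "Field m' \<noteq> {}"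
  shows "m =o m'"
proof -
  have W: "Well_order m" "Well_order m'"
    using assms(2,4) by (auto simp: is_lim_along_def card_order_on_well_order_on)
  have "\<not> m <o m'" "\<not> m' <o m"
    using assms is_lim_along_not_less by blast+
  then show ?thesis
    using W by (simp add: ordIso_iff_ordLeq not_ordLess_iff_ordLeq)
qed

definition ultraproduct :: "'k set \<Rightarrow> ('k \<Rightarrow> 'a set) \<Rightarrow> 'k filter \<Rightarrow> ('k \<Rightarrow> 'a) set set" where
  "ultraproduct I A D =
     Pi\<^sub>E I A // {(f, g). f \<in> Pi\<^sub>E I A \<and> g \<in> Pi\<^sub>E I A \<and> (\<forall>\<^sub>F i in D. f i = g i)}"

end

theory Submission
  imports Defs
begin

text \<open>
  Let \<open>h : \<theta> \<rightarrow> \<lambda>\<close> be cofinal and let \<open>g\<close> witness weak normality. Take \<open>\<lambda>\<^sub>i\<close> to be the cardinality of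
  \<open>sup {h \<epsilon> | \<epsilon> < g i}\<close>. As \<open>\<theta> \<le> \<kappa> < 2\<^sup>\<kappa> < \<lambda>\<close>, the cardinal \<open>\<lambda>\<close> is singular, hence a limit, and so
  \<open>\<lambda>\<close> is the limit of the \<open>\<lambda>\<^sub>i\<close>. If \<open>f i < sup {h \<epsilon> | \<epsilon> < g i}\<close> for all \<open>i\<close>, then choosing \<open>\<epsilon> < g i\<close>
  with \<open>f i < h \<epsilon>\<close> is regressive, so weak normality bounds \<open>f\<close> on a set of \<open>D\<close> by a fixed
  \<open>\<alpha> < \<lambda>\<close>. Hence the ultraproduct has at most \<open>\<Sum>\<^sub>\<alpha> |\<alpha>|\<^sup>\<kappa> \<le> \<lambda>\<close> elements, and the (almost) constant
  functions show that it has at least \<open>\<lambda>\<close>.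
\<close>

section \<open>Order facts about infinite cardinals\<close>

lemma Cinfinite_underS_greater:
  assumes "Cinfinite r" "a \<in> Field r"
  obtains b where "b \<in> Field r" "a \<in> underS r b"
  using assms infinite_Card_order_limit[of r a]
  by (auto simp: cinfinite_def underS_def)

lemma underS_le_trans:
  assumes "Card_order r" "a \<in> underS r b" "(b, c) \<in> r"
  shows "a \<in> underS r c"
proof -
  have W: "wo_rel r"
    using assms(1) by (simp add: card_order_on_well_order_on wo_rel_def)
  have "(a, b) \<in> r" "a \<noteq> b"
    using assms(2) by (auto simp: underS_def)
  moreover have "trans r" "antisym r"
    using W by (simp_all add: wo_rel.TRANS wo_rel.ANTISYM)
  ultimately show ?thesis
    using assms(3) unfolding underS_def by (blast dest: transD antisymD)
qed

lemma Card_order_linear: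
  assumes "Card_order r" "a \<in> Field r" "b \<in> Field r"
  shows "(a, b) \<in> r \<or> b \<in> underS r a"
proof -
  have W: "wo_rel r"
    using assms(1) by (simp add: card_order_on_well_order_on wo_rel_def)
  show ?thesis
    using wo_rel.TOTALS[OF W] wo_rel.REFL[OF W] assms(2,3)
    by (auto simp: underS_def refl_on_def)
qed

lemma Card_order_refl:
  assumes "Card_order r" "a \<in> Field r"
  shows "(a, a) \<in> r"
  using Card_order_linear[OF assms assms(2)] by (auto simp: underS_def)

lemma Card_order_upper_bound:
  assumes "Card_order r" "a \<in> Field r" "b \<in> Field r"
  obtains c where "c \<in> Field r" "(a, c) \<in> r" "(b, c) \<in> r"
  using Card_order_linear[OF assms] Card_order_refl[OF assms(1)] assms(2,3)
  by (auto simp: underS_def)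

lemma underS_subset: "(a, b) \<in> r \<Longrightarrow> Card_order r \<Longrightarrow> underS r a \<subseteq> underS r b"
  by (blast intro: underS_le_trans)

section \<open>Cardinal arithmetic: strength, singularity, cofinality\<close>

lemma strong_over_imp_less:
  assumes k: "Cinfinite k" and l: "Cinfinite l" and "strong_over k l"
  shows "k <o l"
proof -
  obtain x where x: "x \<in> Field l"
    using l by (metis cinfinite_def finite.emptyI equals0I)
  \<comment> \<open>Two steps up from \<open>x\<close> give a \<open>z\<close> with at least two
    predecessors, so that k < 2^k \<le> |z|^k < l.\<close>
  obtain y where y: "y \<in> Field l" "x \<in> underS l y"
    by (rule Cinfinite_underS_greater[OF l x])
  obtain z where z: "z \<in> Field l" "y \<in> underS l z"
    by (rule Cinfinite_underS_greater[OF l y(1)])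
  have "x \<in> underS l z"
    using underS_le_trans[of l x y z] l y z by (auto simp: underS_def)
  moreover have "x \<noteq> y"
    using y(2) by (simp add: underS_def)
  moreover have "inj_on (\<lambda>c. if c then x else y) (UNIV :: bool set)"
    using \<open>x \<noteq> y\<close> by (auto simp: inj_on_def)
  ultimately have two: "ctwo \<le>o |underS l z|"
    unfolding ctwo_def
    using z(2) by (intro card_of_ordLeqI[of "\<lambda>c. if c then x else y"]) auto
  have "k <o ctwo ^c k"
    using k ordLess_ctwo_cexp by blast
  also have "ctwo ^c k \<le>o |underS l z| ^c k"
    using two k by (intro cexp_mono1) auto
  also have "|underS l z| ^c k <o l"
    using assms(3) z(1) by (simp add: strong_over_def)
  finally show ?thesis .
qed

text \<open>Otherwise every initial segment of \<open>l\<close> has size at most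
  \<open>|underS l b|\<close>. Then \<open>l\<close> is a union of \<open>t\<close> many such
  segments, indexed by \<open>A\<close>, and has size at most t + |b|, which is below
  \<open>l\<close> because both summands are.\<close>

lemma singular_imp_limit:
  assumes l: "Cinfinite l" and t: "Cinfinite t" and "t <o l"
    and cof: "A \<subseteq> Field l" "cofinal A l" "|A| =o t"
    and b: "b \<in> Field l"
  obtains c where "c \<in> Field l" "|underS l b| <o |underS l c|"
proof (rule ccontr)
  assume "\<not> thesis"
  then have le: "|underS l c| \<le>o |underS l b|" if "c \<in> Field l" for c
    using that \<open>\<And>c. c \<in> Field l \<Longrightarrow> |underS l b| <o |underS l c| \<Longrightarrow> thesis\<close>
    by (meson card_of_Well_order not_ordLeq_iff_ordLess)
  have "|underS l b| <o l"
    using l b by (simp add: card_of_underS)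
  then have "|Field t <+> underS l b| <o l"
    using assms(1-3) card_of_Plus_ordLess_infinite_Field[of l "Field t" "underS l b"]
      card_of_Field_ordIso ordIso_ordLess_trans by (auto simp: cinfinite_def)
  then have s_less: "t +c |underS l b| <o l"
    by (simp add: csum_def Field_card_of)
  let ?s = "t +c |underS l b|"
  have s: "Cinfinite ?s"
    using t by (simp add: Cinfinite_csum1)
  have "Field l \<subseteq> (\<Union>a\<in>A. underS l a)"
    using cof(2) by (force simp: cofinal_def underS_def)
  then have "|Field l| \<le>o |\<Union>a\<in>A. underS l a|"
    by (rule card_of_mono1)
  also have "|\<Union>a\<in>A. underS l a| \<le>o ?s"
  proof (rule card_of_UNION_ordLeq_infinite_Field)
    show "\<not> finite (Field ?s)" "Card_order ?s"
      using s by (auto simp: cinfinite_def)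
    show "|A| \<le>o ?s"
      using ordIso_ordLeq_trans[OF cof(3) ordLeq_csum1] t by blast
    show "\<forall>a\<in>A. |underS l a| \<le>o ?s"
      using cof(1) by (auto intro!: ordLeq_transitive[OF le ordLeq_csum2[OF card_of_Card_order]])
  qed
  finally have "l \<le>o ?s"
    using ordIso_ordLeq_trans[OF ordIso_symmetric[OF card_of_Field_ordIso]] l by blast
  with s_less show False
    using not_ordLess_ordLeq by blast
qed

text \<open>A set smaller than the cofinality is not cofinal, so some \<open>a\<close> lies strictly
  below none of its members and, by linearity, bounds it. An upper bound of \<open>a\<close> and a
  point strictly above \<open>x\<close> then serves.\<close>

lemma has_cofinality_bounded:
  assumes l: "Cinfinite l" and cof: "has_cofinality l t"
    and "B \<subseteq> Field l" "|B| <o t" "x \<in> Field l"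
  obtains b where "b \<in> Field l" "x \<in> underS l b" "\<And>y. y \<in> B \<Longrightarrow> (y, b) \<in> l"
proof -
  have "\<not> cofinal B l"
    using assms(2-4) not_ordLess_ordLeq unfolding has_cofinality_def by blast
  then obtain a where a: "a \<in> Field l" "\<And>y. y \<in> B \<Longrightarrow> a \<notin> underS l y"
    by (auto simp: cofinal_def underS_def)
  obtain x' where x': "x' \<in> Field l" "x \<in> underS l x'"
    by (rule Cinfinite_underS_greater[OF l assms(5)])
  obtain b where b: "b \<in> Field l" "(a, b) \<in> l" "(x', b) \<in> l"
    using l a(1) x'(1) by (blast intro: Card_order_upper_bound)
  have "trans l"
    using l by (meson card_order_on_well_order_on wo_rel.TRANS wo_rel_def)
  have "(y, b) \<in> l" if "y \<in> B" for y
  proof -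
    have "(y, a) \<in> l"
      using Card_order_linear[of l y a] l a that assms(3) by blast
    then show ?thesis
      using b(2) \<open>trans l\<close> by (blast dest: transD)
  qed
  moreover have "x \<in> underS l b"
    using underS_le_trans[OF _ x'(2) b(3)] l by blast
  ultimately show ?thesis
    using that b(1) by blast
qed

section \<open>Size bounds for ultraproducts\<close>

lemma eq_eventually_equiv:
  "equiv (Pi\<^sub>E I A) {(f, g). f \<in> Pi\<^sub>E I A \<and> g \<in> Pi\<^sub>E I A \<and> (\<forall>\<^sub>F i in D. f i = g i)}"
proof (rule equivI)
  show "sym {(f, g). f \<in> Pi\<^sub>E I A \<and> g \<in> Pi\<^sub>E I A \<and> (\<forall>\<^sub>F i in D. f i = g i)}"
    by (auto intro!: symI elim: eventually_mono)
  show "trans {(f, g). f \<in> Pi\<^sub>E I A \<and> g \<in> Pi\<^sub>E I A \<and> (\<forall>\<^sub>F i in D. f i = g i)}"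
    by (auto intro!: transI elim: eventually_elim2)
qed (auto simp: refl_on_def)

text \<open>Functions that are constant on a set of \<open>D\<close> are pairwise inequivalent for
  different constants, since \<open>D\<close> is proper. Where the constant is not in the factor, an
  arbitrary element of the factor replaces it.\<close>

lemma card_ultraproduct_ge:
  fixes X :: "'a set"
  assumes D: "D \<noteq> bot" "D \<le> principal I"
    and ne: "\<And>i. i \<in> I \<Longrightarrow> A i \<noteq> {}"
    and ev: "\<And>a. a \<in> X \<Longrightarrow> \<forall>\<^sub>F i in D. a \<in> A i"
  shows "|X| \<le>o |ultraproduct I A D|"
proof -
  define E where "E = {(f, g). f \<in> Pi\<^sub>E I A \<and> g \<in> Pi\<^sub>E I A \<and> (\<forall>\<^sub>F i in D. f i = g i)}"
  define c where "c a = (\<lambda>i\<in>I. if a \<in> A i then a else (SOME y. y \<in> A i))" for a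
  have I: "\<forall>\<^sub>F i in D. i \<in> I"
    using D(2) by (simp add: le_principal)
  have c: "c a \<in> Pi\<^sub>E I A" for a
    using ne by (auto simp: c_def some_in_eq)
  have ev_c: "\<forall>\<^sub>F i in D. c a i = a" if "a \<in> X" for a
    using ev[OF that] I by eventually_elim (simp add: c_def)
  have "inj_on (\<lambda>a. E `` {c a}) X"
  proof (rule inj_onI)
    fix a b assume ab: "a \<in> X" "b \<in> X" "E `` {c a} = E `` {c b}"
    have "(c a, c b) \<in> E"
      using eq_equiv_class[OF ab(3)] eq_eventually_equiv c unfolding E_def by blast
    then have "\<forall>\<^sub>F i in D. c a i = c b i"
      by (simp add: E_def)
    with ev_c[OF ab(1)] ev_c[OF ab(2)] have "\<forall>\<^sub>F i in D. a = b"
      by eventually_elim metis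
    then show "a = b"
      using D(1) by (simp add: eventually_const_iff)
  qed
  moreover have "(\<lambda>a. E `` {c a}) ` X \<subseteq> ultraproduct I A D"
    using c unfolding ultraproduct_def E_def[symmetric] by (blast intro: quotientI)
  ultimately show ?thesis
    using card_of_ordLeq by blast
qed

text \<open>Every class is determined by a function from \<open>Field k\<close> into a single
  \<open>B b\<close>. There are at most \<open>l\<close> functions for each \<open>b\<close> and
  \<open>l\<close> many \<open>b\<close>, hence at most \<open>l\<close> classes.\<close>

lemma card_ultraproduct_le:
  fixes A :: "'k \<Rightarrow> 'a set" and l :: "'l rel" and B :: "'l \<Rightarrow> 'a set"
  assumes D: "D \<noteq> bot" "D \<le> principal (Field k)"
    and l: "Cinfinite l" and k: "Card_order k"
    and B: "\<And>b. b \<in> Field l \<Longrightarrow> |B b| ^c k \<le>o l"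
    and bounded: "\<And>f. f \<in> Pi\<^sub>E (Field k) A \<Longrightarrow> \<exists>b\<in>Field l. \<forall>\<^sub>F i in D. f i \<in> B b"
  shows "|ultraproduct (Field k) A D| \<le>o l"
proof -
  \<comment> \<open>\<open>u\<close> may lie outside the product: the default value used to push a
    representative into \<open>B b\<close> need not belong to the factors.\<close>
  define cls where
    "cls u = {f \<in> Pi\<^sub>E (Field k) A. \<forall>\<^sub>F i in D. u i = f i}" for u
  let ?F = "\<lambda>b. Func (Field k) (B b)"
  have I: "\<forall>\<^sub>F i in D. i \<in> Field k"
    using D(2) by (simp add: le_principal)
  have "ultraproduct (Field k) A D \<subseteq> (\<Union>b\<in>Field l. cls ` ?F b)"
  proof
    fix X assume "X \<in> ultraproduct (Field k) A D"
    then obtain f where f: "f \<in> Pi\<^sub>E (Field k) A" and X: "X = cls f"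
      by (auto simp: ultraproduct_def quotient_def cls_def)
    obtain b where b: "b \<in> Field l" "\<forall>\<^sub>F i in D. f i \<in> B b"
      using bounded[OF f] by blast
    obtain y where y: "y \<in> B b"
      using eventually_happens[OF b(2)] D(1) by (auto simp: trivial_limit_def)
    define u where "u i = (if i \<in> Field k then if f i \<in> B b then f i else y else undefined)" for i
    have "u \<in> ?F b"
      using y by (auto simp: Func_def u_def)
    have "\<forall>\<^sub>F i in D. u i = f i"
      using I b(2) by eventually_elim (simp add: u_def)
    then have "cls f = cls u"
      unfolding cls_def by (auto elim: eventually_elim2)
    with X b(1) \<open>u \<in> ?F b\<close> show "X \<in> (\<Union>b\<in>Field l. cls ` ?F b)"
      by blast
  qed
  then have "|ultraproduct (Field k) A D| \<le>o |\<Union>b\<in>Field l. cls ` ?F b|"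
    by (rule card_of_mono1)
  also have "|\<Union>b\<in>Field l. cls ` ?F b| \<le>o l"
  proof (rule card_of_UNION_ordLeq_infinite_Field)
    show "\<not> finite (Field l)" "Card_order l"
      using l by (auto simp: cinfinite_def)
    then show "|Field l| \<le>o l"
      by (simp add: card_of_Field_ordIso ordIso_imp_ordLeq)
    show "\<forall>b\<in>Field l. |cls ` ?F b| \<le>o l"
    proof
      fix b assume "b \<in> Field l"
      then have "|?F b| \<le>o l"
        using B[of b] by (simp add: cexp_def Field_card_of)
      then show "|cls ` ?F b| \<le>o l"
        by (rule ordLeq_transitive[OF card_of_image])
    qed
  qed
  finally show ?thesis .
qed

section \<open>The factors, their limit and their ultraproduct\<close>

theorem proposition2p1:
  fixes k :: "'k rel" and t :: "'t rel" and l :: "'l rel" and D :: "'k filter"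
  assumes "Cinfinite k" and "Cinfinite t" and "Cinfinite l"
    and "has_cofinality l t"
    and "ultrafilter_on (Field k) D"
    and "weakly_normal k t D"
    and "strong_over k l"
  shows "\<exists>L :: 'k \<Rightarrow> 'l rel.
           (\<forall>i \<in> Field k. Card_order (L i)) \<and>
           is_lim_along D L l \<and>
           |ultraproduct (Field k) (\<lambda>i. Field (L i)) D| =o l"
proof -
  have D: "D \<noteq> bot" "D \<le> principal (Field k)"
    using assms(5) by (auto simp: ultrafilter_on_def)
  have I: "\<forall>\<^sub>F i in D. i \<in> Field k"
    using D(2) by (simp add: le_principal)
  have kl: "k <o l"
    using strong_over_imp_less assms(1,3,7) by blast
  obtain A where A: "A \<subseteq> Field l" "cofinal A l" "|A| =o t"
    using assms(4) by (auto simp: has_cofinality_def)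
  have "|A| =o |Field t|"
    using ordIso_transitive[OF A(3) ordIso_symmetric[OF card_of_Field_ordIso]] assms(2) by blast
  then obtain h where "bij_betw h (Field t) A"
    using card_of_ordIso[of "Field t" A] ordIso_symmetric[of "|A|" "|Field t|"] by blast
  then have h: "h ` Field t = A"
    by (simp add: bij_betw_imp_surj_on)
  have h_Field: "h e \<in> Field l" if "e \<in> Field t" for e
    using that h A(1) by blast
  have h_cofinal: "\<exists>e\<in>Field t. a \<in> underS l (h e)" if "a \<in> Field l" for a
    using A(2) that unfolding cofinal_def h[symmetric] by (auto simp: underS_def)
  obtain g where g: "g \<in> Field k \<rightarrow> Field t"
    and g_large: "\<And>e. e \<in> Field t \<Longrightarrow> \<forall>\<^sub>F i in D. (e, g i) \<in> t"
    and g_normal: "\<And>f. regressive k t g f \<Longrightarrow> \<exists>j\<in>Field t. \<forall>\<^sub>F i in D. f i \<in> underS t j"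
    using assms(6) by (auto simp: weakly_normal_def weakly_normal_wrt_def)
  \<comment> \<open>Weak normality gives only e \<le> g i; strictness comes from applying it to some
    e' > e.\<close>
  have g_greater: "\<forall>\<^sub>F i in D. e \<in> underS t (g i)" if e: "e \<in> Field t" for e
  proof -
    have card: "Card_order t"
      using assms(2) by blast
    obtain e' where e': "e' \<in> Field t" "e \<in> underS t e'"
      by (rule Cinfinite_underS_greater[OF assms(2) e])
    show ?thesis
      using g_large[OF e'(1)] by eventually_elim (rule underS_le_trans[OF card e'(2)])
  qed
  obtain x where x: "x \<in> Field l"
    using assms(3) by (metis cinfinite_def finite.emptyI equals0I)
  \<comment> \<open>Fewer than \<open>t\<close> indices lie below \<open>j\<close>, so the
    corresponding values of \<open>h\<close>, which need not be monotone, are bounded in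
    \<open>l\<close>.\<close>
  have "\<exists>b\<in>Field l. x \<in> underS l b \<and> (\<forall>e\<in>underS t j. (h e, b) \<in> l)" if "j \<in> Field t" for j
  proof -
    have "|h ` underS t j| <o t"
      using assms(2) that by (intro ordLeq_ordLess_trans[OF card_of_image] card_of_underS) auto
    moreover have "h ` underS t j \<subseteq> Field l"
      using h_Field underS_Field[of _ t j] by blast
    ultimately obtain b where "b \<in> Field l" "x \<in> underS l b"
        "\<And>y. y \<in> h ` underS t j \<Longrightarrow> (y, b) \<in> l"
        using has_cofinality_bounded[OF assms(3,4) _ _ x] by blast
    then show ?thesis
      by blast
  qed
  then obtain bnd where bnd: "\<And>j. j \<in> Field t \<Longrightarrow> bnd j \<in> Field l"
      "\<And>j. j \<in> Field t \<Longrightarrow> x \<in> underS l (bnd j)"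
      "\<And>j e. j \<in> Field t \<Longrightarrow> e \<in> underS t j \<Longrightarrow> (h e, bnd j) \<in> l"
    by metis

  \<comment> \<open>The points \<open>bnd (g i)\<close> are cofinal in \<open>l\<close>: given a < h
    e, some \<open>i\<close> has e < g i, whence h e \<le> bnd (g i). There are at most
    \<open>k\<close> of them.\<close>
  have "t \<le>o k"
  proof -
    have "cofinal (bnd ` g ` Field k) l"
      unfolding cofinal_def
    proof
      fix a assume "a \<in> Field l"
      then obtain e where e: "e \<in> Field t" "a \<in> underS l (h e)"
        using h_cofinal by blast
      have "\<forall>\<^sub>F i in D. i \<in> Field k \<and> e \<in> underS t (g i)"
        using I g_greater[OF e(1)] by eventually_elim simp
      then obtain i where i: "i \<in> Field k" "e \<in> underS t (g i)"
        using eventually_happens D(1) by (auto simp: trivial_limit_def)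
      have "a \<in> underS l (bnd (g i))"
        using underS_le_trans[OF _ e(2) bnd(3)[OF _ i(2)]] i(1) g assms(3) by blast
      then show "\<exists>b\<in>bnd ` g ` Field k. a \<noteq> b \<and> (a, b) \<in> l"
        using i(1) by (auto simp: underS_def)
    qed
    moreover have "bnd ` g ` Field k \<subseteq> Field l"
      using bnd(1) g by blast
    ultimately have "t \<le>o |bnd ` g ` Field k|"
      using assms(4) by (simp add: has_cofinality_def)
    also have "|bnd ` g ` Field k| \<le>o |Field k|"
      unfolding image_image by (rule card_of_image)
    also have "|Field k| =o k"
      using assms(1) card_of_Field_ordIso by blast
    finally show ?thesis .
  qed
  then have tl: "t <o l"
    using kl by (rule ordLeq_ordLess_trans)

  \<comment> \<open>Adding \<open>x\<close> only serves to keep the factors with \<open>g i = 0\<close> nonempty.\<close>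
  define S where "S i = insert x (\<Union>e\<in>underS t (g i). underS l (h e))" for i
  have S_Field: "S i \<subseteq> Field l" for i
    using x underS_Field[of _ l] unfolding S_def by blast
  have S_large: "\<forall>\<^sub>F i in D. underS l (h e) \<subseteq> S i" if "e \<in> Field t" for e
    using g_greater[OF that] by eventually_elim (auto simp: S_def)
  have "is_lim_along D (\<lambda>i. |S i| ) l"
    unfolding is_lim_along_def
  proof (intro conjI ballI)
    show "Card_order l"
      using assms(3) by blast
    fix b assume b: "b \<in> Field l"
    \<comment> \<open>Passing to a larger cardinality first makes the inequality strict:
      \<open>S i\<close> contains \<open>underS l c\<close> for \<open>D\<close>-almost all
      \<open>i\<close>.\<close>
    obtain c where c: "c \<in> Field l" "|underS l b| <o |underS l c|"
      by (rule singular_imp_limit[OF assms(3,2) tl A b])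
    obtain e where e: "e \<in> Field t" "c \<in> underS l (h e)"
      using h_cofinal[OF c(1)] by blast
    show "\<forall>\<^sub>F i in D. Restr l (underS l b) <o |S i| \<and> |S i| \<le>o l"
      using S_large[OF e(1)]
    proof eventually_elim
      case (elim i)
      have "underS l c \<subseteq> underS l (h e)"
        using e(2) assms(3) by (intro underS_subset) (auto simp: underS_def)
      with elim have less: "|underS l b| <o |S i|"
        by (intro ordLess_ordLeq_trans[OF c(2)] card_of_mono1) blast
      have "Field (Restr l (underS l b)) \<subseteq> underS l b"
        by (auto simp: Field_def)
      then have "|Field (Restr l (underS l b))| <o |S i|"
        using ordLeq_ordLess_trans[OF card_of_mono1 less] by blast
      moreover have W: "Well_order (Restr l (underS l b))"
        using assms(3) by (simp add: card_order_on_well_order_on Well_order_Restr)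
      \<comment> \<open>A well-order at least as long as the cardinal \<open>|S i|\<close> would
        have a field at least as large.\<close>
      ultimately have "Restr l (underS l b) <o |S i|"
        using card_of_mono2[of "|S i|" "Restr l (underS l b)"] not_ordLess_ordLeq
          not_ordLess_iff_ordLeq[OF card_of_Well_order W]
        by (auto simp: Field_card_of)
      moreover have "|S i| \<le>o l"
        using ordLeq_ordIso_trans[OF card_of_mono1[OF S_Field] card_of_Field_ordIso] assms(3)
        by blast
      ultimately show ?case ..
    qed
  qed
  moreover have "|Field l| \<le>o |ultraproduct (Field k) S D|"
  proof (rule card_ultraproduct_ge[OF D])
    fix a assume "a \<in> Field l"
    then obtain e where e: "e \<in> Field t" "a \<in> underS l (h e)"
      using h_cofinal by blast
    show "\<forall>\<^sub>F i in D. a \<in> S i"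
      using S_large[OF e(1)] by eventually_elim (use e(2) in blast)
  qed (simp add: S_def)
  moreover have "|ultraproduct (Field k) S D| \<le>o l"
  proof (rule card_ultraproduct_le[OF D assms(3), where B = "underS l"])
    show "Card_order k"
      using assms(1) by blast
    show "|underS l b| ^c k \<le>o l" if "b \<in> Field l" for b
      using assms(7) that ordLess_imp_ordLeq by (auto simp: strong_over_def)
    fix f assume f: "f \<in> Pi\<^sub>E (Field k) S"
    \<comment> \<open>The index \<open>e\<close> < \<open>g i\<close> with \<open>f i\<close> below
      \<open>h e\<close> will be the value of a regressive function \<open>p\<close>; where
      \<open>g i\<close> is zero, \<open>g i\<close> itself is a harmless default.\<close>
    have "\<exists>e\<in>Field t. (underS t (g i) \<noteq> {} \<longrightarrow> e \<in> underS t (g i)) \<and>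
        (underS t (g i) \<noteq> {} \<longrightarrow> f i \<in> insert x (underS l (h e)))" if i: "i \<in> Field k" for i
    proof (cases "underS t (g i) = {}")
      case True
      then show ?thesis
        using g i by blast
    next
      case False
      have "f i \<in> S i"
        using f i by auto
      then show ?thesis
        using False underS_Field[of _ t "g i"] unfolding S_def by blast
    qed
    then obtain p where p: "\<And>i. i \<in> Field k \<Longrightarrow> p i \<in> Field t"
        "\<And>i. i \<in> Field k \<Longrightarrow> underS t (g i) \<noteq> {} \<Longrightarrow> p i \<in> underS t (g i)"
        "\<And>i. i \<in> Field k \<Longrightarrow> underS t (g i) \<noteq> {} \<Longrightarrow> f i \<in> insert x (underS l (h (p i)))"
      by metis
    have "regressive k t g p"
      using p by (auto simp: regressive_def)
    then obtain j where j: "j \<in> Field t" "\<forall>\<^sub>F i in D. p i \<in> underS t j"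
      using g_normal by blast
    \<comment> \<open>\<open>g_greater\<close> excludes the indices where \<open>g i\<close> is
      zero. Elsewhere \<open>f i\<close> is \<open>x\<close> or lies below h (p i) \<le> bnd j, as p
      i < j.\<close>
    have "\<forall>\<^sub>F i in D. f i \<in> underS l (bnd j)"
      using I j(2) g_greater[OF j(1)]
    proof eventually_elim
      case (elim i)
      then have "f i = x \<or> f i \<in> underS l (h (p i))"
        using p(3) by blast
      then show ?case
        using bnd(2)[OF j(1)] underS_le_trans[OF _ _ bnd(3)[OF j(1) elim(2)]] assms(3) by blast
    qed
    then show "\<exists>b\<in>Field l. \<forall>\<^sub>F i in D. f i \<in> underS l b"
      using bnd(1)[OF j(1)] by blast
  qed
  moreover have "l =o |Field l|"
    using ordIso_symmetric[OF card_of_Field_ordIso] assms(3) by blast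
  ultimately have "is_lim_along D (\<lambda>i. |S i| ) l" "|ultraproduct (Field k) S D| =o l"
    using ordIso_ordLeq_trans[of l "|Field l|" "|ultraproduct (Field k) S D|"]
    by (simp_all add: ordIso_iff_ordLeq)
  \<comment> \<open>The cardinal \<open>|S i|\<close> has field exactly \<open>S i\<close>, so the
    two ultraproducts coincide.\<close>
  then show ?thesis
    by (intro exI[of _ "\<lambda>i. |S i|"]) (simp add: Field_card_of card_of_card_order_on)
qed

end
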